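(* Let $p$ be a prime, $j\geq 1$ an integer, $N=p^j-1$, and $m\in\{1,2,\ldots,p^j-1\}$. Write $m=p^\nu M$ with $\nu\geq 0$ and $p\nmid M$, and write the base-$p$ expansion $M=[m_\theta,\ldots,m_1,m_0]_p$ with $0\leq\theta<j$ and $m_\theta\geq 1$. Then any $m$-fold base-$p$ addition of $N$ generates exactly $(m-1)j$ carries, and the base-$p$ expansion of $MN$ is \[ \big[m_\theta,\ldots,m_1,(m_0-1),\underbrace{(p-1),\ldots,(p-1)}_{j-\theta-1\text{ times}},(p-m_\theta-1),\ldots,(p-m_1-1),(p-m_0)\big]_p. \]
   Context: $[d_\theta,\ldots,d_1,d_0]_p$ denotes the integer $\sum_{i=0}^{\theta}d_ip^i$ with base-$p$ digits $d_i$ (most significant digit first). When adding two nonnegative integers in base $p$ by the schoolbook algorithm, a carry occurs at a position whenever the digit sum plus the incoming carry is at least $p$. An $m$-fold base-$p$ addition of $N$ is an addition of $m$ copies of $N$ in base $p$ that is fully parenthesized (every pair of parentheses encloses exactly two summands), and its number of carries is the total over all binary additions performed. *)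

theory Defs
  imports "HOL-Computational_Algebra.Primes"
begin

text \<open>Digit lists are written most significant digit first, as in
  \<open>[d\<^sub>\<theta>, \<dots>, d\<^sub>1, d\<^sub>0]\<^sub>p\<close>.\<close>

definition base_value :: "nat \<Rightarrow> nat list \<Rightarrow> nat" where
  "base_value p ds = (\<Sum>i<length ds. rev ds ! i * p ^ i)"

text \<open>Leading zeros are not excluded.\<close>

definition base_expansion :: "nat \<Rightarrow> nat \<Rightarrow> nat list \<Rightarrow> bool" where
  "base_expansion p n ds \<longleftrightarrow> (\<forall>d\<in>set ds. d < p) \<and> n = base_value p ds"

definition digit :: "nat \<Rightarrow> nat \<Rightarrow> nat \<Rightarrow> nat" where
  "digit p n i = n div p ^ i mod p"

primrec carry_in :: "nat \<Rightarrow> nat \<Rightarrow> nat \<Rightarrow> nat \<Rightarrow> nat" where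
  "carry_in p a b 0 = 0"
| "carry_in p a b (Suc i) = (if p \<le> digit p a i + digit p b i + carry_in p a b i then 1 else 0)"

definition carry_positions :: "nat \<Rightarrow> nat \<Rightarrow> nat \<Rightarrow> nat set" where
  "carry_positions p a b = {i. p \<le> digit p a i + digit p b i + carry_in p a b i}"

text \<open>A fully parenthesized sum: each \<open>Plus\<close> is one pair of parentheses enclosing two summands.\<close>

datatype addition = Summand nat | Plus addition addition

primrec summands :: "addition \<Rightarrow> nat list" where
  "summands (Summand n) = [n]"
| "summands (Plus s t) = summands s @ summands t"

primrec result :: "addition \<Rightarrow> nat" where
  "result (Summand n) = n"
| "result (Plus s t) = result s + result t"

primrec carries :: "nat \<Rightarrow> addition \<Rightarrow> nat" where
  "carries p (Summand n) = 0"
| "carries p (Plus s t) = carries p s + carries p t + card (carry_positions p (result s) (result t))"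

definition fold_addition :: "nat \<Rightarrow> nat \<Rightarrow> addition \<Rightarrow> bool" where
  "fold_addition m N t \<longleftrightarrow> summands t = replicate m N"

text \<open>The carries defined above are those of the usual algorithm: they produce the correct digits
  of the sum, and only finitely many occur.\<close>

lemma mod_power_Suc_digit: "n mod p ^ Suc i = digit p n i * p ^ i + n mod p ^ i"
  unfolding digit_def power_Suc2 mod_mult2_eq by simp

lemma carry_in_invariant:
  assumes "p > 0"
  shows "a mod p ^ i + b mod p ^ i = carry_in p a b i * p ^ i + (a + b) mod p ^ i"
proof (induction i)
  case 0
  show ?case by simp
next
  case (Suc i)
  let ?s = "digit p a i + digit p b i + carry_in p a b i"
  let ?c = "carry_in p a b (Suc i)"
  have lt: "digit p n i < p" for n using assms by (simp add: digit_def)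
  have "carry_in p a b i \<le> 1" by (cases i) auto
  with lt[of a] lt[of b] have s: "?s = ?c * p + (?s - ?c * p)" "?s - ?c * p < p" by auto
  have "(a + b) mod p ^ i < p ^ i" using assms by simp
  moreover have "(?s - ?c * p + 1) * p ^ i \<le> p * p ^ i"
    using s(2) by (intro mult_right_mono) auto
  ultimately have small: "(?s - ?c * p) * p ^ i + (a + b) mod p ^ i < p ^ Suc i"
    by (simp add: algebra_simps)
  have sum: "a mod p ^ Suc i + b mod p ^ Suc i = ?s * p ^ i + (a + b) mod p ^ i"
    using Suc unfolding mod_power_Suc_digit by (simp add: algebra_simps)
  also have "\<dots> = ?c * p ^ Suc i + ((?s - ?c * p) * p ^ i + (a + b) mod p ^ i)"
    by (subst s(1)) (simp only: algebra_simps power_Suc)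
  finally have eq: "a mod p ^ Suc i + b mod p ^ Suc i
    = ?c * p ^ Suc i + ((?s - ?c * p) * p ^ i + (a + b) mod p ^ i)" .
  have "(a + b) mod p ^ Suc i = (a mod p ^ Suc i + b mod p ^ Suc i) mod p ^ Suc i"
    by (simp only: mod_add_eq)
  also have "\<dots> = (?s - ?c * p) * p ^ i + (a + b) mod p ^ i"
    unfolding eq using small by (metis mod_less mod_mult_self3)
  finally show ?case using eq by simp
qed

lemma digit_add:
  assumes "p > 0"
  shows "digit p (a + b) i = (digit p a i + digit p b i + carry_in p a b i) mod p"
proof -
  have q: "p ^ i > 0" using assms by simp
  have "a + b = (a div p ^ i) * p ^ i + (b div p ^ i) * p ^ i + (a mod p ^ i + b mod p ^ i)"
    by (metis add.assoc add.left_commute div_mult_mod_eq)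
  also have "\<dots> = (a div p ^ i + b div p ^ i + carry_in p a b i) * p ^ i + (a + b) mod p ^ i"
    unfolding carry_in_invariant[OF assms] by (simp add: algebra_simps)
  finally have "(a + b) div p ^ i = a div p ^ i + b div p ^ i + carry_in p a b i"
    using q by (metis add_right_cancel div_mult_mod_eq mult_right_cancel less_numeral_extra(3))
  then show ?thesis unfolding digit_def by (metis mod_add_eq mod_add_left_eq)
qed

lemma finite_carry_positions:
  assumes "p \<ge> 2"
  shows "finite (carry_positions p a b)"
proof (rule finite_subset)
  show "carry_positions p a b \<subseteq> {..a + b}"
  proof
    fix i assume "i \<in> carry_positions p a b"
    then have c: "carry_in p a b (Suc i) = 1" by (simp add: carry_positions_def)
    have "p ^ Suc i \<le> a mod p ^ Suc i + b mod p ^ Suc i"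
      using carry_in_invariant[of p a "Suc i" b] assms unfolding c by simp
    also have "\<dots> \<le> a + b" by (intro add_mono) auto
    finally have "p ^ Suc i \<le> a + b" .
    moreover have "Suc i < p ^ Suc i" using assms by (intro power_gt_expt) auto
    ultimately show "i \<in> {..a + b}" by simp
  qed
qed simp

end

theory Submission imports Defs begin

text \<open>
  By Legendre's carry count, adding \<open>x\<close> and \<open>y\<close> in base \<open>p\<close> costs
  \<open>(s x + s y - s (x + y)) / (p - 1)\<close> carries, where \<open>s\<close> is the digit sum.
  For \<open>1 \<le> a \<le> p\<^sup>j\<close> we have \<open>a * N = (a - 1) * p\<^sup>j + (N - (a - 1))\<close>, and the two blocks are
  digitwise complementary, so \<open>s (a * N) = j * (p - 1)\<close> does not depend on \<open>a\<close>.
  Hence each of the \<open>m - 1\<close> binary additions produces exactly \<open>j\<close> carries. The same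
  decomposition for \<open>a = M\<close> gives the expansion of \<open>M * N\<close>.
\<close>

section \<open>Digit sums and complementary blocks\<close>

definition digit_sum :: "nat \<Rightarrow> nat \<Rightarrow> nat \<Rightarrow> nat" where
  "digit_sum p k n = (\<Sum>i<k. digit p n i)"

lemma digit_sum_Suc: "digit_sum p (Suc k) n = n mod p + digit_sum p k (n div p)"
  unfolding digit_sum_def sum.lessThan_Suc_shift
  by (simp add: digit_def div_mult2_eq)

text \<open>The bound keeps \<open>y\<close> inside the lowest \<open>k\<close> positions, so the
  two blocks do not overlap.\<close>

lemma digit_sum_append:
  assumes "y < p ^ k"
  shows "digit_sum p (k + l) (x * p ^ k + y) = digit_sum p l x + digit_sum p k y"
  using assms
proof (induction k arbitrary: y)
  case 0
  then show ?case by (simp add: digit_sum_def)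
next
  case (Suc k)
  then have p: "p > 0" by (cases p) auto
  have eq: "x * p ^ Suc k + y = y + p * (x * p ^ k)" by simp
  have "y div p < p ^ k"
    using Suc.prems by (simp add: less_mult_imp_div_less mult.commute)
  then show ?case
    unfolding add_Suc digit_sum_Suc eq
    using Suc.IH[of "y div p"] p by (simp add: add.commute)
qed

text \<open>Subtraction from \<open>p ^ k - 1\<close>, whose digits are all \<open>p - 1\<close>,
  never borrows, so every position contributes \<open>p - 1\<close>.\<close>

lemma digit_sum_complement:
  assumes "x < p ^ k"
  shows "digit_sum p k x + digit_sum p k (p ^ k - 1 - x) = k * (p - 1)"
  using assms
proof (induction k arbitrary: x)
  case 0
  then show ?case by (simp add: digit_sum_def)
next
  case (Suc k)
  then have p: "p > 0" by (cases p) auto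
  let ?q = "x div p" and ?r = "x mod p"
  have q: "?q < p ^ k"
    using Suc.prems by (simp add: less_mult_imp_div_less mult.commute)
  have r: "?r < p" using p by simp
  have "p ^ Suc k = p * (p ^ k - 1 - ?q) + p * ?q + p"
  proof -
    have "p ^ k = (p ^ k - 1 - ?q) + ?q + 1" using q by simp
    then have "p * p ^ k = p * ((p ^ k - 1 - ?q) + ?q + 1)" by (rule arg_cong)
    then show ?thesis by (simp only: power_Suc distrib_left mult_1_right)
  qed
  moreover have "x = p * ?q + ?r" by simp
  \<comment> \<open>No borrow occurs: the last digit and the quotient are complemented
    separately.\<close>
  ultimately have eq: "p ^ Suc k - 1 - x = (p - 1 - ?r) + p * (p ^ k - 1 - ?q)"
    using r by linarith
  have "(p - 1 - ?r) div p = 0" "(p - 1 - ?r) mod p = p - 1 - ?r"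
    using p by simp_all
  then have mod_div: "(p ^ Suc k - 1 - x) mod p = p - 1 - ?r" "(p ^ Suc k - 1 - x) div p = p ^ k - 1 - ?q"
    unfolding eq using p by simp_all
  show ?case
    unfolding digit_sum_Suc mult_Suc mod_div using Suc.IH[OF q] r by linarith
qed

lemma digit_sum_mult_pred_power:
  assumes "1 \<le> a" "a \<le> p ^ j"
  shows "digit_sum p (j + j) (a * (p ^ j - 1)) = j * (p - 1)"
proof -
  \<comment> \<open>It is \<open>b = a - 1\<close> that must fit into \<open>j\<close> digits, so
    \<open>a = p ^ j\<close> is still allowed.\<close>
  obtain b where b: "a = Suc b" using assms by (cases a) auto
  have "b * (p ^ j - 1) = b * p ^ j - b" by (simp add: diff_mult_distrib2)
  moreover have "b \<le> b * p ^ j" using assms by simp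
  ultimately have "a * (p ^ j - 1) = b * p ^ j + (p ^ j - 1 - b)"
    using assms b by simp
  then show ?thesis
    using digit_sum_append[of "p ^ j - 1 - b" p j j b] digit_sum_complement[of b p j] assms b
    by simp
qed

section \<open>Carry counting by digit sums\<close>

lemma digit_sum_add:
  assumes "p > 0"
  shows "digit_sum p k (a + b) + p * (\<Sum>i<k. carry_in p a b (Suc i))
    = digit_sum p k a + digit_sum p k b + (\<Sum>i<k. carry_in p a b i)"
proof -
  \<comment> \<open>A carry takes \<open>p\<close> out of its column; column totals stay below
    \<open>2 * p\<close>, so one unit of carry suffices.\<close>
  have "digit p (a + b) i + p * carry_in p a b (Suc i) = digit p a i + digit p b i + carry_in p a b i"
    for i
  proof -
    let ?s = "digit p a i + digit p b i + carry_in p a b i"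
    have "digit p n i < p" for n using assms by (simp add: digit_def)
    from this[of a] this[of b] have "?s < 2 * p"
      by (cases i) auto
    then have "?s mod p = (if p \<le> ?s then ?s - p else ?s)"
      by (simp add: le_mod_geq)
    then show ?thesis using digit_add[OF assms, of a b i] by simp
  qed
  then have "(\<Sum>i<k. digit p (a + b) i + p * carry_in p a b (Suc i))
    = (\<Sum>i<k. digit p a i + digit p b i + carry_in p a b i)" by presburger
  then show ?thesis
    unfolding digit_sum_def sum_distrib_left sum.distrib .
qed

lemma carry_in_eq_0:
  assumes "p > 0" "a + b < p ^ i"
  shows "carry_in p a b i = 0"
  using carry_in_invariant[OF assms(1), of a i b] assms by simp

text \<open>Each carry removes \<open>p\<close> from one column and adds 1 to the next, a net loss
  of \<open>p - 1\<close>. The bound on \<open>a + b\<close> ensures that no carry leaves the top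
  column.\<close>

lemma card_carry_positions:
  assumes "p > 0" "a + b < p ^ k"
  shows "digit_sum p k (a + b) + (p - 1) * card (carry_positions p a b)
    = digit_sum p k a + digit_sum p k b"
proof -
  let ?c = "carry_in p a b"
  have "carry_positions p a b \<subseteq> {..<k}"
  proof
    fix i assume "i \<in> carry_positions p a b"
    then have "?c (Suc i) \<noteq> 0" by (simp add: carry_positions_def)
    then have "p ^ Suc i \<le> a + b" using carry_in_eq_0[OF assms(1), of a b "Suc i"] by linarith
    show "i \<in> {..<k}"
    proof (rule ccontr)
      assume "i \<notin> {..<k}"
      then have "p ^ k \<le> p ^ Suc i" using assms(1) by (intro power_increasing) auto
      with \<open>p ^ Suc i \<le> a + b\<close> assms(2) show False by simp
    qed
  qed
  then have pos: "carry_positions p a b = {i \<in> {..<k}. p \<le> digit p a i + digit p b i + ?c i}"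
    by (auto simp: carry_positions_def)
  have card: "card (carry_positions p a b) = (\<Sum>i<k. ?c (Suc i))"
    unfolding pos card_eq_sum by (subst sum.inter_filter) simp_all
  \<comment> \<open>The sums of incoming and outgoing carries differ only in the end terms
    \<open>?c 0\<close> and \<open>?c k\<close>, and both vanish.\<close>
  have "(\<Sum>i<k. ?c i) + ?c k = ?c 0 + (\<Sum>i<k. ?c (Suc i))"
    by (metis sum.lessThan_Suc sum.lessThan_Suc_shift)
  then have shift: "(\<Sum>i<k. ?c i) = (\<Sum>i<k. ?c (Suc i))"
    using carry_in_eq_0[OF assms] by simp
  have "p = (p - 1) + 1" using assms(1) by simp
  then have "p * card (carry_positions p a b)
      = (p - 1) * card (carry_positions p a b) + card (carry_positions p a b)"
    by (metis add_mult_distrib mult_1)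
  then show ?thesis
    using digit_sum_add[OF assms(1), of k a b] unfolding shift card[symmetric] by linarith
qed

text \<open>All three digit sums equal \<open>j * (p - 1)\<close>, so the carry count follows by
  cancelling \<open>p - 1\<close>. Since the total is below \<open>p ^ (j + j)\<close>,
  \<open>j + j\<close> positions hold every digit.\<close>

lemma card_carry_positions_multiples:
  assumes "p \<ge> 2" "1 \<le> a" "1 \<le> b" "a + b \<le> p ^ j"
  shows "card (carry_positions p (a * (p ^ j - 1)) (b * (p ^ j - 1))) = j"
proof -
  let ?N = "p ^ j - 1"
  have sum: "a * ?N + b * ?N = (a + b) * ?N" by (simp add: add_mult_distrib)
  have "(a + b) * ?N \<le> p ^ j * ?N" using assms(4) by (rule mult_right_mono) simp
  also have "\<dots> < p ^ j * p ^ j" using assms(1) by simp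
  finally have "a * ?N + b * ?N < p ^ (j + j)" unfolding sum power_add .
  from card_carry_positions[OF _ this]
  have "j * (p - 1) + (p - 1) * card (carry_positions p (a * ?N) (b * ?N)) = j * (p - 1) + j * (p - 1)"
    using assms digit_sum_mult_pred_power[of a p j] digit_sum_mult_pred_power[of b p j]
      digit_sum_mult_pred_power[of "a + b" p j] by (simp only: sum)
  then show ?thesis using assms(1) by simp
qed

section \<open>Parenthesized sums of equal summands\<close>

lemma summands_nonempty: "summands t \<noteq> []"
  by (induction t) auto

text \<open>Counting the leaves of the two subtrees splits \<open>m\<close>; both parts are positive
  because every tree has a leaf.\<close>

lemma fold_addition_Plus:
  assumes "fold_addition m N (Plus s t)"
  obtains a b where "m = a + b" "1 \<le> a" "1 \<le> b" "fold_addition a N s" "fold_addition b N t"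
proof
  let ?a = "length (summands s)" and ?b = "length (summands t)"
  have eq: "summands s @ summands t = replicate m N"
    using assms by (simp add: fold_addition_def)
  then show m: "m = ?a + ?b" by (metis length_append length_replicate)
  show "1 \<le> ?a" "1 \<le> ?b" using summands_nonempty by (simp_all add: Suc_le_eq)
  show "fold_addition ?a N s" "fold_addition ?b N t"
    using eq unfolding m replicate_add fold_addition_def by simp_all
qed

lemma result_fold_addition: "fold_addition m N t \<Longrightarrow> result t = m * N"
proof (induction t arbitrary: m)
  case (Summand n)
  then show ?case by (cases m) (auto simp: fold_addition_def)
next
  case (Plus s t)
  then show ?case by (elim fold_addition_Plus) (simp add: add_mult_distrib)
qed

text \<open>A node splitting \<open>m\<close> into \<open>a + b\<close> adds \<open>j\<close>
  carries to \<open>(a - 1) * j\<close> and \<open>(b - 1) * j\<close>, so the shape of the tree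
  does not matter.\<close>

lemma carries_fold_addition:
  assumes "p \<ge> 2" "fold_addition m (p ^ j - 1) t" "m \<le> p ^ j"
  shows "carries p t = (m - 1) * j"
  using assms(2,3)
proof (induction t arbitrary: m)
  case (Summand n)
  then have "m = 1" by (cases m) (auto simp: fold_addition_def)
  then show ?case by simp
next
  case (Plus s t)
  from Plus.prems(1) obtain a b where ab: "m = a + b" "1 \<le> a" "1 \<le> b"
    "fold_addition a (p ^ j - 1) s" "fold_addition b (p ^ j - 1) t"
    by (rule fold_addition_Plus)
  have "carries p (Plus s t) = (a - 1) * j + (b - 1) * j + j"
    using Plus ab assms(1) card_carry_positions_multiples[of p a b j]
    by (simp add: result_fold_addition)
  also have "\<dots> = ((a - 1) + (b - 1) + 1) * j" by (simp only: add_mult_distrib mult_1)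
  also have "(a - 1) + (b - 1) + 1 = m - 1" using ab by simp
  finally show ?case .
qed

section \<open>Values of digit lists and the expansion\<close>

lemma base_value_Nil [simp]: "base_value p [] = 0"
  by (simp add: base_value_def)

lemma base_value_Cons: "base_value p (x # xs) = x * p ^ length xs + base_value p xs"
  unfolding base_value_def by (simp add: nth_append)

lemma base_value_append:
  "base_value p (xs @ ys) = base_value p xs * p ^ length ys + base_value p ys"
  by (induction xs) (simp_all add: base_value_Cons power_add algebra_simps)

text \<open>Paired digits add up to \<open>p - 1\<close>, so the two values add up to the largest
  number with that many digits.\<close>

lemma base_value_complement:
  assumes "\<forall>x\<in>set xs. f x < p"
  shows "base_value p (map f xs) + base_value p (map (\<lambda>x. p - f x - 1) xs) + 1 = p ^ length xs"
  using assms
proof (induction xs)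
  case Nil
  then show ?case by simp
next
  case (Cons x xs)
  have "f x * p ^ length xs + (p - f x - 1) * p ^ length xs + p ^ length xs
      = (f x + (p - f x - 1) + 1) * p ^ length xs"
    by (simp only: add_mult_distrib mult_1)
  also have "f x + (p - f x - 1) + 1 = p" using Cons.prems by simp
  finally show ?case using Cons by (simp add: base_value_Cons)
qed

lemma base_value_replicate_pred:
  assumes "p > 0"
  shows "base_value p (replicate k (p - 1)) + 1 = p ^ k"
proof -
  \<comment> \<open>The block of digits \<open>p - 1\<close> is the complement of a block of
    zeros.\<close>
  have "base_value p (replicate k 0) = 0"
    by (induction k) (simp_all add: base_value_Cons)
  then show ?thesis
    using base_value_complement[of "replicate k 0" "\<lambda>x. x" p] assms by simp
qed

text \<open>As \<open>d 0\<close> is positive, \<open>M - 1\<close> differs from \<open>M\<close>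
  only in its last digit; this is the high block. Padding \<open>M - 1\<close> with zeros to
  \<open>j\<close> digits and complementing gives the low block: the zeros become
  \<open>p - 1\<close>, and \<open>d 0 - 1\<close> becomes \<open>p - d 0\<close>.\<close>

lemma base_expansion_mult_pred_power:
  assumes exp: "base_expansion p M (rev (map d [0..<\<theta> + 1]))" and d0: "d 0 \<ge> 1" and "\<theta> < j"
  shows "base_expansion p (M * (p ^ j - 1))
    (rev (map d [1..<\<theta> + 1]) @ [d 0 - 1]
     @ replicate (j - \<theta> - 1) (p - 1)
     @ rev (map (\<lambda>i. p - d i - 1) [1..<\<theta> + 1]) @ [p - d 0])"
proof -
  define I where "I = rev [1..<\<theta> + 1]"
  define k where "k = j - \<theta> - 1"
  define A where "A = base_value p (map d I)"
  define B where "B = base_value p (map (\<lambda>i. p - d i - 1) I)"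
  define R where "R = base_value p (replicate k (p - 1))"
  let ?ds = "map d I @ [d 0 - 1] @ replicate k (p - 1) @ map (\<lambda>i. p - d i - 1) I @ [p - d 0]"
  have length_I: "length I = \<theta>" by (simp add: I_def del: upt_Suc)
  have "[0..<\<theta> + 1] = 0 # [1..<\<theta> + 1]" by (simp add: upt_conv_Cons)
  then have split: "rev (map d [0..<\<theta> + 1]) = map d I @ [d 0]" by (simp add: rev_map I_def)
  have lt: "d 0 < p" "\<forall>i\<in>set I. d i < p"
    using exp unfolding base_expansion_def split by auto
  have "M = base_value p (map d I @ [d 0])"
    using exp unfolding base_expansion_def split by simp
  then have M: "M = A * p + d 0"
    by (simp add: base_value_append base_value_Cons A_def)
  have AB: "A + B + 1 = p ^ \<theta>"
    unfolding A_def B_def base_value_complement[OF lt(2)] length_I ..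
  have R: "R + 1 = p ^ k"
    unfolding R_def using lt(1) by (intro base_value_replicate_pred) simp
  have "j = k + \<theta> + 1" using assms(3) by (simp add: k_def)
  then have j: "p ^ j = p ^ k * p ^ \<theta> * p" by (simp add: power_add)
  have "base_value p ?ds
    = (A * p + (d 0 - 1)) * (p ^ k * p ^ \<theta> * p) + R * p ^ \<theta> * p + B * p + (p - d 0)"
    by (simp add: base_value_append base_value_Cons power_add length_I algebra_simps
        A_def B_def R_def)
  also have "\<dots> = M * (p ^ j - 1)"
  \<comment> \<open>The powers telescope: the three lower blocks add up to \<open>p ^ j - M\<close>,
    and the high block is \<open>M * p ^ j - p ^ j\<close>.\<close>
  proof -
    have "R * p ^ \<theta> * p + p ^ \<theta> * p = p ^ j"
      unfolding j R[symmetric] by (simp add: algebra_simps)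
    moreover have "A * p + B * p + p = p ^ \<theta> * p"
      unfolding AB[symmetric] by (simp add: algebra_simps)
    moreover have "(A * p + (d 0 - 1)) * p ^ j + p ^ j = M * p ^ j"
      using d0 by (cases "d 0") (simp_all add: M algebra_simps)
    moreover have "M * (p ^ j - 1) = M * p ^ j - M"
      by (simp add: diff_mult_distrib2)
    ultimately show ?thesis unfolding j[symmetric] using M lt(1) by linarith
  qed
  finally have "base_expansion p (M * (p ^ j - 1)) ?ds"
    using lt d0 unfolding base_expansion_def by auto
  then show ?thesis unfolding I_def k_def rev_map .
qed

theorem theorem6:
  fixes p j N m \<nu> M \<theta> :: nat and d :: "nat \<Rightarrow> nat"
  assumes "prime p"
    and "j \<ge> 1"
    and "N = p ^ j - 1"
    and "m \<in> {1..p ^ j - 1}"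
    and "m = p ^ \<nu> * M"
    and "\<not> p dvd M"
    and "base_expansion p M (rev (map d [0..<\<theta> + 1]))"
    and "d \<theta> \<ge> 1"
  shows "\<theta> < j
    \<and> (\<forall>t. fold_addition m N t \<longrightarrow> carries p t = (m - 1) * j)
    \<and> base_expansion p (M * N)
        (rev (map d [1..<\<theta> + 1]) @ [d 0 - 1]
         @ replicate (j - \<theta> - 1) (p - 1)
         @ rev (map (\<lambda>i. p - d i - 1) [1..<\<theta> + 1]) @ [p - d 0])"
proof -
  have p: "p \<ge> 2" using assms(1) by (rule prime_ge_2_nat)
  have M_eq: "M = base_value p (rev (map d [0..<\<theta> + 1]))"
    using assms(7) by (simp add: base_expansion_def)
  \<comment> \<open>The nonzero leading digit bounds \<open>M\<close> from below, and comparing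
    powers of \<open>p\<close> bounds \<open>\<theta>\<close>.\<close>
  have "p ^ \<theta> \<le> d \<theta> * p ^ \<theta>" using assms(8) by simp
  also have "\<dots> \<le> M" unfolding M_eq by (simp add: base_value_Cons)
  also have "\<dots> \<le> m" unfolding assms(5) using p by simp
  also have "m < p ^ j" using assms(4) p by auto
  finally have \<theta>: "\<theta> < j" using p by simp
  \<comment> \<open>A zero last digit would make \<open>p\<close> divide \<open>M\<close>.\<close>
  have "d 0 \<noteq> 0"
  proof
    assume "d 0 = 0"
    moreover have "[0..<\<theta> + 1] = 0 # [1..<\<theta> + 1]" by (simp add: upt_conv_Cons)
    ultimately have "M = base_value p (rev (map d [1..<\<theta> + 1])) * p"
      unfolding M_eq by (simp add: base_value_append base_value_Cons)
    then show False using assms(6) by simp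
  qed
  then show ?thesis
    using \<theta> base_expansion_mult_pred_power[OF assms(7) _ \<theta>] carries_fold_addition[OF p] assms(3,4)
    by auto
qed

end
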